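(* If $A$ and $B$ are two distinct given points, their common line can be constructed by a match-stick construction following Postulates i, ii and iii below. If $l$ and $p$ are given lines, one can also construct the parallel to $l$ which passes through $B$, as well as the perpendicular to $p$ which passes through $B$.
   Context: We work in the Euclidean plane with a fixed unit of length. A match-stick (or stick) is a closed line segment of length exactly $1$; its endpoints are called its extremities. A match-stick construction is a finite sequence of steps, starting from given objects, each permitted by the following postulates ("given" means initially given or obtained in an earlier step): Postulate i. One may lay a match-stick through any two given points at distance equal to or less than the unit, where one or even two of the points may be chosen as extremity of the stick segment. This procedure also permits us to determine whether the distance of two given points is strictly less than, equal to, or strictly greater than the unit. Postulate ii. One may choose an arbitrary point on a given stick segment, and it can be chosen such that it is none of the extremities. Postulate iii. From a given point, one may use a match-stick as a unitary ruler. This ruler does not leave a trace, but can be used to determine a point with unit distance to the given point and relatively to a given set of match-sticks (for instance, the points of given sticks at distance exactly $1$ from the given point, or that there are none). No two match-sticks can be used as a compass at the same time. Intersection points of laid sticks count as constructed points. As usual for geometric constructions, "arbitrary" choices are auxiliary: the constructed object must not depend on them. A line is given, or constructed, when it is determined by a laid stick segment contained in it; such a segment may be extended along the line to any desired length. No bound is assumed on the distances between the given points and lines. A line is regarded as parallel to itself. *)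

theory Defs
  imports "HOL-Analysis.Analysis"
begin

type_synonym point = "real^2"

definition is_line :: "point set \<Rightarrow> bool" where
  "is_line l \<longleftrightarrow> (\<exists>a b. a \<noteq> b \<and> l = affine hull {a, b})"

definition perpendicular :: "point set \<Rightarrow> point set \<Rightarrow> bool" where
  "perpendicular l m \<longleftrightarrow> (\<forall>a\<in>l. \<forall>b\<in>l. \<forall>c\<in>m. \<forall>d\<in>m. orthogonal (a - b) (c - d))"

definition is_stick :: "point set \<Rightarrow> bool" where
  "is_stick s \<longleftrightarrow> (\<exists>a b. dist a b = 1 \<and> s = closed_segment a b)"

definition extremities :: "point set \<Rightarrow> point set" where
  "extremities s = {a. \<exists>b. dist a b = 1 \<and> s = closed_segment a b}"

definition line_given :: "point set set \<Rightarrow> point set \<Rightarrow> bool" where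
  "line_given S l \<longleftrightarrow> is_line l \<and> (\<exists>s\<in>S. s \<subseteq> l)"

text \<open>
  \<open>constructible L P S\<close>: starting from the given points \<open>P\<close> and the given (laid) sticks \<open>S\<close>,
  the line \<open>L\<close> can be constructed. The outcome of an arbitrary choice is universally quantified in
  the premise of the corresponding rule: the construction has to go on, in finitely many further
  steps that may depend on the outcome, to the same line \<open>L\<close>, whatever has been chosen. The
  decisions permitted by the postulates (comparing the distance of two given points with the unit,
  or noticing that no point of a given stick has unit distance to a given point) add no object;
  they only guide which step to take next, and that may depend freely on the configuration here.
  There is no step intersecting two circles.

  Postulate i is given by \<open>lay_through\<close>, which leaves the position of the stick on the line
  arbitrary, and by \<open>lay_from\<close>, which makes the given point \<open>X\<close> an extremity; then \<open>Y\<close> is the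
  other one if the distance is exactly 1. Postulate ii is \<open>choose_on_stick\<close>; a choice that
  might also be an extremity would be less useful. Postulate iii is given by
  \<open>ruler_on_stick\<close> and by \<open>ruler_off_sticks\<close>, an arbitrary point at unit distance lying on
  none of finitely many given sticks (for no sticks: an arbitrary point at unit distance). As
  finitely many sticks never cover a unit circle, such a point always exists.
\<close>

inductive constructible :: "point set \<Rightarrow> point set \<Rightarrow> point set set \<Rightarrow> bool"
  for L :: "point set" where
  finished: "line_given S L \<Longrightarrow> constructible L P S"
| lay_through:
    "\<lbrakk>X \<in> P; Y \<in> P; X \<noteq> Y; dist X Y \<le> 1;
      \<And>s. \<lbrakk>is_stick s; X \<in> s; Y \<in> s\<rbrakk> \<Longrightarrow> constructible L P (insert s S)\<rbrakk>
     \<Longrightarrow> constructible L P S"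
| lay_from:
    "\<lbrakk>X \<in> P; Y \<in> P; X \<noteq> Y; dist X Y \<le> 1; is_stick s; X \<in> extremities s; Y \<in> s;
      constructible L P (insert s S)\<rbrakk>
     \<Longrightarrow> constructible L P S"
| extremity:
    "\<lbrakk>s \<in> S; X \<in> extremities s; constructible L (insert X P) S\<rbrakk>
     \<Longrightarrow> constructible L P S"
| intersection:
    "\<lbrakk>s \<in> S; t \<in> S; s \<inter> t = {X}; constructible L (insert X P) S\<rbrakk>
     \<Longrightarrow> constructible L P S"
| choose_on_stick:
    "\<lbrakk>s \<in> S; \<And>X. X \<in> s - extremities s \<Longrightarrow> constructible L (insert X P) S\<rbrakk>
     \<Longrightarrow> constructible L P S"
| ruler_on_stick:
    "\<lbrakk>C \<in> P; s \<in> S; X \<in> s; dist C X = 1; constructible L (insert X P) S\<rbrakk>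
     \<Longrightarrow> constructible L P S"
| ruler_off_sticks:
    "\<lbrakk>C \<in> P; T \<subseteq> S; finite T;
      \<And>X. \<lbrakk>dist C X = 1; X \<notin> \<Union>T\<rbrakk> \<Longrightarrow> constructible L (insert X P) S\<rbrakk>
     \<Longrightarrow> constructible L P S"

end

theory Submission
  imports Defs
begin

text \<open>
  Everything reduces to one construction: erecting the perpendicular to a drawn line at a given
  point \<open>q\<close> of it (\<open>drawn_perpendicular_at\<close>). If \<open>C\<close> has unit distance to \<open>q\<close>, the unit circle
  around \<open>C\<close> meets the line again in a point \<open>p\<close>, and prolonging the stick from \<open>p\<close> to \<open>C\<close> by a
  unit ends, by Thales, on the perpendicular at \<open>q\<close>. That point may be too far away from \<open>q\<close> to be
  joined with it by a stick; but among three essentially different choices of \<open>C\<close>, two points of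
  the perpendicular are distinct and close enough to each other.

  A stick can be prolonged along its line in unit steps, so a single stick spans a whole square
  grid of unit sticks around it. Hence every given point \<open>X\<close>, however remote, has distance at most
  \<open>1/2\<close> from some drawn parallel of a given line. The unit circle around \<open>X\<close> then yields an
  isosceles triangle with apex \<open>X\<close> and base on that parallel, and the perpendiculars to its
  legs, erected at the base points, meet on its axis of symmetry, close to \<open>X\<close>. That gives the
  axis and therefore the parallel and the perpendicular through \<open>X\<close>
  (\<open>drawn_parallel\<close>).

  For the line through remote points \<open>A\<close> and \<open>B\<close>, choose a frame at \<open>A\<close> and project \<open>B\<close> to its axes.
  Projecting a point of an axis to another line through \<open>A\<close> and back shrinks its coordinate
  by the square of a cosine. Doing so equally often for both coordinates yields a point on the
  segment from \<open>A\<close> to \<open>B\<close> so close to \<open>A\<close> that a stick joins them (\<open>drawn_line_through\<close>).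
\<close>

section \<open>Obtainable points and sticks\<close>

lemma constructible_mono:
  assumes "constructible L P S" "P \<subseteq> P'" "S \<subseteq> S'"
  shows "constructible L P' S'"
  using assms
proof (induction arbitrary: P' S')
  case (finished S P)
  then show ?case by (meson constructible.finished line_given_def subsetD)
next
  case (lay_through X P Y S)
  have "constructible L P' (insert s S')" if "is_stick s" "X \<in> s" "Y \<in> s" for s
    using lay_through that by (meson insert_mono)
  then show ?case using lay_through.hyps lay_through.prems by (meson constructible.lay_through subsetD)
next
  case (lay_from X P Y s S)
  have "constructible L P' (insert s S')"
    using lay_from by (meson insert_mono)
  then show ?case using lay_from.hyps lay_from.prems by (meson constructible.lay_from subsetD)
next
  case (extremity s S X P)
  have "constructible L (insert X P') S'"
    using extremity by (meson insert_mono)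
  then show ?case using extremity.hyps extremity.prems by (meson constructible.extremity subsetD)
next
  case (intersection s S t X P)
  have "constructible L (insert X P') S'"
    using intersection by (meson insert_mono)
  then show ?case using intersection.hyps intersection.prems by (meson constructible.intersection subsetD)
next
  case (choose_on_stick s S P)
  have "constructible L (insert X P') S'" if "X \<in> s - extremities s" for X
    using choose_on_stick that by (meson insert_mono)
  then show ?case using choose_on_stick.hyps choose_on_stick.prems by (meson constructible.choose_on_stick subsetD)
next
  case (ruler_on_stick C P s S X)
  have "constructible L (insert X P') S'"
    using ruler_on_stick by (meson insert_mono)
  then show ?case using ruler_on_stick.hyps ruler_on_stick.prems by (meson constructible.ruler_on_stick subsetD)
next
  case (ruler_off_sticks C P T S)
  have "constructible L (insert X P') S'" if "dist C X = 1" "X \<notin> \<Union>T" for X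
    using ruler_off_sticks that by (meson insert_mono)
  then show ?case using ruler_off_sticks.hyps ruler_off_sticks.prems
    by (meson constructible.ruler_off_sticks subsetD subset_trans)
qed

text \<open>
  The objects \<open>P'\<close> and \<open>S'\<close> are obtained as auxiliary objects for whatever construction comes next.
  Quantifying over the goal \<open>L\<close> and over all larger configurations \<open>Q\<close>, \<open>R\<close> makes this notion
  compose like entailment, although the derivations of \<open>constructible\<close> branch over
  the arbitrary choices: what is obtained below never depends on them.
\<close>
definition yields ::
    "point set \<Rightarrow> point set set \<Rightarrow> point set \<Rightarrow> point set set \<Rightarrow> bool" where
  "yields P S P' S' \<longleftrightarrow> (\<forall>L Q R. P \<subseteq> Q \<longrightarrow> S \<subseteq> R \<longrightarrow>
     constructible L (Q \<union> P') (R \<union> S') \<longrightarrow> constructible L Q R)"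

lemma yieldsI:
  assumes "\<And>L Q R. \<lbrakk>P \<subseteq> Q; S \<subseteq> R; constructible L (Q \<union> P') (R \<union> S')\<rbrakk> \<Longrightarrow> constructible L Q R"
  shows "yields P S P' S'"
  using assms unfolding yields_def by blast

lemma yieldsD:
  assumes "yields P S P' S'" "P \<subseteq> Q" "S \<subseteq> R" "constructible L (Q \<union> P') (R \<union> S')"
  shows "constructible L Q R"
  using assms unfolding yields_def by blast

lemma yields_given:
  assumes "P' \<subseteq> P" "S' \<subseteq> S"
  shows "yields P S P' S'"
proof (rule yieldsI)
  fix L Q R assume "P \<subseteq> Q" "S \<subseteq> R" "constructible L (Q \<union> P') (R \<union> S')"
  moreover have "Q \<union> P' = Q" "R \<union> S' = R" using calculation assms by auto
  ultimately show "constructible L Q R" by simp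
qed

lemma yields_weaken:
  assumes "yields P S P' S'" "P'' \<subseteq> P'" "S'' \<subseteq> S'"
  shows "yields P S P'' S''"
proof (rule yieldsI)
  fix L Q R assume 1: "P \<subseteq> Q" "S \<subseteq> R" "constructible L (Q \<union> P'') (R \<union> S'')"
  have "constructible L (Q \<union> P') (R \<union> S')"
    by (rule constructible_mono[OF 1(3)]) (use assms in auto)
  then show "constructible L Q R" by (rule yieldsD[OF assms(1) 1(1,2)])
qed

lemma yields_more:
  assumes "yields P S P' S'" "P \<subseteq> Q" "S \<subseteq> R"
  shows "yields Q R P' S'"
  using assms unfolding yields_def by (meson subset_trans)

lemma yields_trans:
  assumes "yields P S P' S'" "yields (P \<union> P') (S \<union> S') P'' S''"
  shows "yields P S P'' S''"
proof (rule yieldsI)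
  fix L Q R assume 1: "P \<subseteq> Q" "S \<subseteq> R" "constructible L (Q \<union> P'') (R \<union> S'')"
  have "constructible L (Q \<union> P' \<union> P'') (R \<union> S' \<union> S'')"
    by (rule constructible_mono[OF 1(3)]) auto
  then have "constructible L (Q \<union> P') (R \<union> S')"
    using 1 by (intro yieldsD[OF assms(2), of "Q \<union> P'" "R \<union> S'"]) auto
  then show "constructible L Q R" by (rule yieldsD[OF assms(1) 1(1,2)])
qed

lemma yields_Un:
  assumes "yields P S P' S'" "yields P S P'' S''"
  shows "yields P S (P' \<union> P'') (S' \<union> S'')"
proof (rule yieldsI)
  fix L Q R
  assume 1: "P \<subseteq> Q" "S \<subseteq> R" "constructible L (Q \<union> (P' \<union> P'')) (R \<union> (S' \<union> S''))"
  have "constructible L (Q \<union> P') (R \<union> S')"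
    using 1 by (intro yieldsD[OF assms(2), of "Q \<union> P'" "R \<union> S'"]) (auto simp: Un_assoc)
  then show "constructible L Q R" by (rule yieldsD[OF assms(1) 1(1,2)])
qed

abbreviation yields_point :: "point set \<Rightarrow> point set set \<Rightarrow> point \<Rightarrow> bool" where
  "yields_point P S X \<equiv> yields P S {X} {}"

abbreviation yields_stick :: "point set \<Rightarrow> point set set \<Rightarrow> point set \<Rightarrow> bool" where
  "yields_stick P S s \<equiv> yields P S {} {s}"

lemma yields_stick_from:
  assumes "yields_point P S X" "yields_point P S Y" "X \<noteq> Y" "dist X Y \<le> 1"
    "is_stick s" "X \<in> extremities s" "Y \<in> s"
  shows "yields_stick P S s"
proof (rule yields_trans[OF yields_Un[OF assms(1,2)]], rule yieldsI)
  fix L Q R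
  assume "P \<union> ({X} \<union> {Y}) \<subseteq> Q" "S \<union> ({} \<union> {}) \<subseteq> R" "constructible L (Q \<union> {}) (R \<union> {s})"
  then show "constructible L Q R" using constructible.lay_from[of X Q Y s L R] assms by simp
qed

lemma yields_extremity:
  assumes "yields_stick P S s" "X \<in> extremities s"
  shows "yields_point P S X"
proof (rule yields_trans[OF assms(1)], rule yieldsI)
  fix L Q R
  assume "P \<union> {} \<subseteq> Q" "S \<union> {s} \<subseteq> R" "constructible L (Q \<union> {X}) (R \<union> {})"
  then show "constructible L Q R" using constructible.extremity[of s R X L Q] assms by simp
qed

lemma yields_intersection:
  assumes "yields_stick P S s" "yields_stick P S t" "s \<inter> t = {X}"
  shows "yields_point P S X"
proof (rule yields_trans[OF yields_Un[OF assms(1,2)]], rule yieldsI)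
  fix L Q R
  assume "P \<union> ({} \<union> {}) \<subseteq> Q" "S \<union> ({s} \<union> {t}) \<subseteq> R" "constructible L (Q \<union> {X}) (R \<union> {})"
  then show "constructible L Q R" using constructible.intersection[of s R t X L Q] assms by simp
qed

lemma yields_unit_distance:
  assumes "yields_point P S C" "yields_stick P S s" "X \<in> s" "dist C X = 1"
  shows "yields_point P S X"
proof (rule yields_trans[OF yields_Un[OF assms(1,2)]], rule yieldsI)
  fix L Q R
  assume "P \<union> ({C} \<union> {}) \<subseteq> Q" "S \<union> ({} \<union> {s}) \<subseteq> R" "constructible L (Q \<union> {X}) (R \<union> {})"
  then show "constructible L Q R" using constructible.ruler_on_stick[of C Q s R X L] assms by simp
qed

text \<open>
  An arbitrary choice is harmless as soon as the same objects are obtained from every outcome; the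
  chosen point itself is forgotten afterwards.
\<close>
lemma yields_by_choice_on_stick:
  assumes s: "yields_stick P S s"
    and indep: "\<And>X. X \<in> s - extremities s \<Longrightarrow> yields (insert X P) S P' S'"
  shows "yields P S P' S'"
proof (rule yields_trans[OF s], rule yieldsI)
  fix L Q R
  assume 1: "P \<union> {} \<subseteq> Q" "S \<union> {s} \<subseteq> R" "constructible L (Q \<union> P') (R \<union> S')"
  have "constructible L (insert X Q) R" if "X \<in> s - extremities s" for X
  proof (rule yieldsD[OF indep[OF that]])
    show "constructible L (insert X Q \<union> P') (R \<union> S')"
      by (rule constructible_mono[OF 1(3)]) auto
  qed (use 1 in auto)
  then show "constructible L Q R" using 1 by (auto intro: constructible.choose_on_stick[of s])
qed

lemma yields_by_choice_at_unit_distance: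
  assumes C: "yields_point P S C"
    and T: "finite T" "yields P S {} T"
    and indep: "\<And>X. \<lbrakk>dist C X = 1; X \<notin> \<Union>T\<rbrakk> \<Longrightarrow> yields (insert X P) S P' S'"
  shows "yields P S P' S'"
proof (rule yields_trans[OF yields_Un[OF C T(2)]], rule yieldsI)
  fix L Q R
  assume 1: "P \<union> ({C} \<union> {}) \<subseteq> Q" "S \<union> ({} \<union> T) \<subseteq> R" "constructible L (Q \<union> P') (R \<union> S')"
  have "constructible L (insert X Q) R" if "dist C X = 1" "X \<notin> \<Union>T" for X
  proof (rule yieldsD[OF indep[OF that]])
    show "constructible L (insert X Q \<union> P') (R \<union> S')"
      by (rule constructible_mono[OF 1(3)]) auto
  qed (use 1 in auto)
  then show "constructible L Q R" using constructible.ruler_off_sticks[of C Q T R] 1 T by auto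
qed

section \<open>Drawn lines\<close>

text \<open>
  The stick is prescribed to start at \<open>a\<close> and to point in direction \<open>d\<close>, so that directions and not
  positions of sticks matter later on; \<open>d\<close> need not be a unit vector.
\<close>
definition drawn :: "point set \<Rightarrow> point set set \<Rightarrow> point \<Rightarrow> point \<Rightarrow> bool" where
  "drawn P S a d \<longleftrightarrow> d \<noteq> 0 \<and> yields P S {a} {closed_segment a (a + sgn d)}"

lemma drawn_nonzero: "drawn P S a d \<Longrightarrow> d \<noteq> 0"
  by (simp add: drawn_def)

lemma drawn_point: "drawn P S a d \<Longrightarrow> yields_point P S a"
  unfolding drawn_def by (blast intro: yields_weaken)

lemma drawn_stick: "drawn P S a d \<Longrightarrow> yields_stick P S (closed_segment a (a + sgn d))"
  unfolding drawn_def by (blast intro: yields_weaken)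

lemma drawnI:
  assumes "d \<noteq> 0" "yields_point P S a" "yields_stick P S (closed_segment a (a + sgn d))"
  shows "drawn P S a d"
  using yields_Un[OF assms(2,3)] assms(1) by (simp add: drawn_def)

lemma unit_segment:
  fixes a u :: point
  assumes "norm u = 1"
  shows "is_stick (closed_segment a (a + u))" "a \<in> extremities (closed_segment a (a + u))"
    "a + u \<in> extremities (closed_segment a (a + u))"
  using assms closed_segment_commute[of a "a + u"]
  by (force simp: is_stick_def extremities_def dist_norm)+

lemma in_unit_segment:
  fixes a u :: point
  assumes "0 \<le> t" "t \<le> 1"
  shows "a + t *\<^sub>R u \<in> closed_segment a (a + u)"
  unfolding in_segment using assms by (intro exI[of _ t]) (auto simp: algebra_simps)

lemma drawn_join:
  assumes a: "yields_point P S a" and b: "yields_point P S b" and "a \<noteq> b" "dist a b \<le> 1"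
  shows "drawn P S a (b - a)"
proof (rule drawnI)
  have n: "norm (sgn (b - a)) = 1" using assms by (simp add: norm_sgn)
  have "b = a + norm (b - a) *\<^sub>R sgn (b - a)" using assms by (simp add: sgn_div_norm)
  moreover have "norm (b - a) \<le> 1" using assms by (simp add: dist_norm norm_minus_commute)
  ultimately have "b \<in> closed_segment a (a + sgn (b - a))"
    using in_unit_segment[of "norm (b - a)" a "sgn (b - a)"] by simp
  then show "yields_stick P S (closed_segment a (a + sgn (b - a)))"
    using yields_stick_from[OF a b] unit_segment[OF n] assms by blast
qed (use assms in auto)

lemma drawn_join_towards:
  assumes "yields_point P S a" "yields_point P S b"
    and b: "b = a + r *\<^sub>R d" and r: "0 < r" "r * norm d \<le> 1" and d: "d \<noteq> 0"
  shows "drawn P S a d"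
proof -
  have e: "b - a = r *\<^sub>R d" using b by simp
  have "drawn P S a (b - a)"
  proof (rule drawn_join[OF assms(1,2)])
    show "a \<noteq> b" using e r d by auto
    show "dist a b \<le> 1" using e r dist_norm[of b a] by (simp add: dist_commute)
  qed
  then show ?thesis unfolding e using r d by (simp add: drawn_def sgn_scaleR)
qed

lemma drawn_endpoint:
  assumes "drawn P S a d"
  shows "yields_point P S (a + sgn d)"
  using yields_extremity[OF drawn_stick[OF assms]] unit_segment[of "sgn d" a] drawn_nonzero[OF assms]
  by (simp add: norm_sgn)

lemma drawn_more:
  assumes "drawn P S a d" "P \<subseteq> Q" "S \<subseteq> R"
  shows "drawn Q R a d"
  using assms yields_more unfolding drawn_def by blast

lemma drawn_reverse:
  assumes "drawn P S a d"
  shows "drawn P S (a + sgn d) (- d)"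
  using assms drawn_endpoint[OF assms] drawn_stick[OF assms]
  by (intro drawnI) (auto simp: drawn_nonzero sgn_minus closed_segment_commute)

text \<open>
  Prolonging a stick \<open>[a, a + u]\<close> by a unit: from an interior point \<open>X\<close>, the stick laid towards \<open>a + u\<close>
  ends beyond it, at \<open>X + u\<close>; then the stick laid from \<open>a + u\<close> towards \<open>X + u\<close> is independent
  of \<open>X\<close>.
\<close>
lemma drawn_next:
  assumes d: "drawn P S a d"
  shows "drawn P S (a + sgn d) d"
  unfolding drawn_def
proof (intro conjI)
  show "d \<noteq> 0" using d by (rule drawn_nonzero)
  define u where "u = sgn d"
  have n: "norm u = 1" using \<open>d \<noteq> 0\<close> by (simp add: u_def norm_sgn)
  show "yields P S {a + sgn d} {closed_segment (a + sgn d) (a + sgn d + sgn d)}"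
    unfolding u_def[symmetric]
  proof (rule yields_by_choice_on_stick[OF drawn_stick[OF d]])
    fix X assume X: "X \<in> closed_segment a (a + sgn d) - extremities (closed_segment a (a + sgn d))"
    let ?P = "insert X P"
    obtain t where t: "X = a + t *\<^sub>R u" "0 \<le> t" "t \<le> 1"
      using X unfolding u_def by (auto simp: in_segment algebra_simps)
    have "t \<noteq> 0" "t \<noteq> 1" using X t unit_segment[OF n, of a] by (auto simp: u_def)
    then have t': "0 < t" "t < 1" using t by auto
    have pX: "yields_point ?P S X" by (simp add: yields_given)
    have pe: "yields_point ?P S (a + u)"
      using yields_more[OF drawn_endpoint[OF d], of ?P S] by (auto simp: u_def)
    have "u \<noteq> 0" using n by auto
    have "drawn ?P S X u"
      using t' n \<open>u \<noteq> 0\<close> by (intro drawn_join_towards[OF pX pe, of "1 - t"]) (auto simp: t algebra_simps)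
    then have pn: "yields_point ?P S (X + u)"
      using drawn_endpoint[of ?P S X u] n by (simp add: sgn_div_norm)
    have "drawn ?P S (a + u) u"
      using t' n \<open>u \<noteq> 0\<close> by (intro drawn_join_towards[OF pe pn, of t]) (auto simp: t algebra_simps)
    then show "yields ?P S {a + u} {closed_segment (a + u) (a + u + u)}"
      using n by (simp add: drawn_def sgn_div_norm)
  qed
qed

lemma drawn_nat_steps:
  assumes "drawn P S a d"
  shows "drawn P S (a + real n *\<^sub>R sgn d) d"
proof (induction n)
  case (Suc n)
  have "a + real (Suc n) *\<^sub>R sgn d = (a + real n *\<^sub>R sgn d) + sgn d" by (simp add: algebra_simps)
  then show ?case using drawn_next[OF Suc] by (simp only:)
qed (use assms in simp)

lemma drawn_minus:
  assumes "drawn P S a d"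
  shows "drawn P S a (- d)"
  using drawn_next[OF drawn_reverse[OF assms]] by (simp add: sgn_minus)

lemma drawn_steps:
  assumes "drawn P S a d"
  shows "drawn P S (a + real_of_int k *\<^sub>R sgn d) d"
proof (cases "k \<ge> 0")
  case True
  then show ?thesis using drawn_nat_steps[OF assms, of "nat k"] by simp
next
  case False
  have "drawn P S (a + real (nat (- k)) *\<^sub>R sgn (- d)) (- (- d))"
    using drawn_minus[OF drawn_nat_steps[OF drawn_minus[OF assms]]] by simp
  then show ?thesis using False by (simp add: sgn_minus)
qed

lemma drawn_stick_through:
  assumes "drawn P S a d"
  obtains s where "yields_stick P S s" "a + t *\<^sub>R d \<in> s" "s \<subseteq> range (\<lambda>r. a + r *\<^sub>R d)"
proof -
  have nz: "d \<noteq> 0" using assms by (rule drawn_nonzero)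
  define k where "k = \<lfloor>t * norm d\<rfloor>"
  define b where "b = a + real_of_int k *\<^sub>R sgn d"
  have "a + t *\<^sub>R d = b + (t * norm d - real_of_int k) *\<^sub>R sgn d"
    using nz by (simp add: b_def sgn_div_norm algebra_simps)
  moreover have "0 \<le> t * norm d - real_of_int k" "t * norm d - real_of_int k \<le> 1"
    unfolding k_def by linarith+
  ultimately have 1: "a + t *\<^sub>R d \<in> closed_segment b (b + sgn d)"
    using in_unit_segment by metis
  have 2: "closed_segment b (b + sgn d) \<subseteq> range (\<lambda>r. a + r *\<^sub>R d)"
  proof
    fix x assume "x \<in> closed_segment b (b + sgn d)"
    then obtain r where "x = b + r *\<^sub>R sgn d" by (auto simp: in_segment algebra_simps)
    then have "x = a + ((real_of_int k + r) / norm d) *\<^sub>R d"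
      by (simp add: b_def sgn_div_norm algebra_simps divide_inverse)
    then show "x \<in> range (\<lambda>r. a + r *\<^sub>R d)" by blast
  qed
  show ?thesis
    using that[OF drawn_stick[OF drawn_steps[OF assms, of k]]] 1 2 by (simp add: b_def)
qed

text \<open>
  The sticks of the unit steps cover the line, so the next grid point beyond \<open>a + t d\<close> lies within
  the reach of a stick.
\<close>
lemma drawn_forward:
  assumes d: "drawn P S a d" and b: "yields_point P S (a + t *\<^sub>R d)"
  shows "drawn P S (a + t *\<^sub>R d) d"
proof -
  have nz: "d \<noteq> 0" using d by (rule drawn_nonzero)
  define k where "k = \<lfloor>t * norm d\<rfloor>"
  define c where "c = a + real_of_int (k + 1) *\<^sub>R sgn d"
  define r where "r = real_of_int (k + 1) - t * norm d"
  have r: "0 < r" "r \<le> 1" unfolding r_def k_def by linarith+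
  have c: "yields_point P S c" unfolding c_def by (rule drawn_point[OF drawn_steps[OF d]])
  have "c = a + t *\<^sub>R d + (r / norm d) *\<^sub>R d"
    using nz by (simp add: c_def r_def sgn_div_norm field_simps flip: scaleR_left.add)
  then show ?thesis using r nz by (intro drawn_join_towards[OF b c, of "r / norm d"]) auto
qed

lemma drawn_along:
  assumes d: "drawn P S a d" and b: "yields_point P S b" and "b = a + t *\<^sub>R d" and "k \<noteq> 0"
  shows "drawn P S b (k *\<^sub>R d)"
proof -
  have f: "drawn P S b d" using drawn_forward[OF d] b assms(3) by blast
  show ?thesis
  proof (cases "k > 0")
    case True
    then show ?thesis using f by (simp add: drawn_def sgn_scaleR)
  next
    case False
    then have "k < 0" using assms by simp
    then show ?thesis using drawn_minus[OF f] by (simp add: drawn_def sgn_scaleR sgn_minus)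
  qed
qed

lemma drawn_line_intersection:
  assumes d: "drawn P S a d" and e: "drawn P S b e"
    and X: "X = a + t *\<^sub>R d" "X = b + r *\<^sub>R e"
    and indep: "\<And>k. d \<noteq> k *\<^sub>R e"
  shows "yields_point P S X"
proof -
  obtain s where s: "yields_stick P S s" "X \<in> s" "s \<subseteq> range (\<lambda>r. a + r *\<^sub>R d)"
    using drawn_stick_through[OF d] X by metis
  obtain s' where s': "yields_stick P S s'" "X \<in> s'" "s' \<subseteq> range (\<lambda>r. b + r *\<^sub>R e)"
    using drawn_stick_through[OF e] X by metis
  have "Y = X" if Y: "Y \<in> s" "Y \<in> s'" for Y
  proof -
    obtain t' r' where Y': "Y = a + t' *\<^sub>R d" "Y = b + r' *\<^sub>R e" using Y s s' by blast
    have eq: "(t' - t) *\<^sub>R d = (r' - r) *\<^sub>R e"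
      using X Y' by (metis add_diff_cancel_left scaleR_left_diff_distrib)
    have "t' = t"
    proof (rule ccontr)
      assume "t' \<noteq> t"
      then have "d = ((r' - r) / (t' - t)) *\<^sub>R e"
        using arg_cong[OF eq, of "\<lambda>x. (1 / (t' - t)) *\<^sub>R x"] by simp
      then show False using indep by blast
    qed
    then show ?thesis using X Y' by simp
  qed
  then have "s \<inter> s' = {X}" using s s' by blast
  then show ?thesis using yields_intersection s s' by blast
qed

lemma drawn_unit_distance_point:
  assumes "drawn P S a d" "yields_point P S C" "X = a + t *\<^sub>R d" "dist C X = 1"
  shows "yields_point P S X"
  using assms drawn_stick_through[OF assms(1), of t] yields_unit_distance by metis

lemma drawn_by_choice_at_unit_distance:
  assumes "d \<noteq> 0" and q: "yields_point P S q" and N: "finite N"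
    "\<And>X. X \<in> N \<Longrightarrow> dist q X = 1 \<and> yields_point P S X"
    and indep: "\<And>C. \<lbrakk>dist q C = 1; C \<notin> N\<rbrakk> \<Longrightarrow> drawn (insert C P) S a d"
  shows "drawn P S a d"
proof -
  have T: "yields P S {} (closed_segment q ` N)"
    using N
  proof (induction N)
    case empty
    then show ?case by (simp add: yields_given)
  next
    case (insert X N)
    have "dist q X = 1" "yields_point P S X" using insert.prems by auto
    then have "is_stick (closed_segment q X)" "q \<in> extremities (closed_segment q X)"
      "X \<in> closed_segment q X"
      by (auto simp: is_stick_def extremities_def)
    then have "yields_stick P S (closed_segment q X)"
      using yields_stick_from[OF q \<open>yields_point P S X\<close>] \<open>dist q X = 1\<close> by fastforce
    then show ?case
      using yields_Un[of P S "{}" "{closed_segment q X}" "{}" "closed_segment q ` N"] insert by simp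
  qed
  have off: "C \<notin> N" if "C \<notin> \<Union> (closed_segment q ` N)" for C
    using that by auto
  have "yields P S {a} {closed_segment a (a + sgn d)}"
  proof (rule yields_by_choice_at_unit_distance[OF q _ T])
    fix X assume "dist q X = 1" "X \<notin> \<Union> (closed_segment q ` N)"
    then show "yields (insert X P) S {a} {closed_segment a (a + sgn d)}"
      using indep off unfolding drawn_def by blast
  qed (use N in simp)
  then show ?thesis using \<open>d \<noteq> 0\<close> by (simp add: drawn_def)
qed

lemma drawn_scale: "\<lbrakk>drawn P S a d; k \<noteq> 0\<rbrakk> \<Longrightarrow> drawn P S a (k *\<^sub>R d)"
  using drawn_along[of P S a d a 0 k] drawn_point by simp

section \<open>Orthonormal frames\<close>

definition frame :: "point \<Rightarrow> point \<Rightarrow> bool" where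
  "frame u v \<longleftrightarrow> norm u = 1 \<and> norm v = 1 \<and> inner u v = 0"

lemma frame_swap: "frame u v \<Longrightarrow> frame v u"
  by (simp add: frame_def inner_commute)

lemma frame_inner:
  assumes "frame u v"
  shows "inner u u = 1" "inner v v = 1" "inner u v = 0" "inner v u = 0"
  using assms by (auto simp: frame_def inner_commute norm_eq_1)

lemma obtain_frame:
  assumes "norm (u :: point) = 1"
  obtains v where "frame u v"
proof
  show "frame u (vector [- (u $ 2), u $ 1])"
    using assms by (simp add: frame_def norm_eq_1 inner_vec_def sum_2 algebra_simps)
qed

lemma frame_expansion:
  assumes "frame u v"
  shows "x = inner x u *\<^sub>R u + inner x v *\<^sub>R v"
proof -
  have "u $ 1 * u $ 1 + u $ 2 * u $ 2 = 1" "v $ 1 * v $ 1 + v $ 2 * v $ 2 = 1"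
    "u $ 1 * v $ 1 + u $ 2 * v $ 2 = 0"
    using frame_inner[OF assms] by (simp_all add: inner_vec_def sum_2)
  then have "x $ 1 = (x $ 1 * u $ 1 + x $ 2 * u $ 2) * u $ 1 + (x $ 1 * v $ 1 + x $ 2 * v $ 2) * v $ 1"
    "x $ 2 = (x $ 1 * u $ 1 + x $ 2 * u $ 2) * u $ 2 + (x $ 1 * v $ 1 + x $ 2 * v $ 2) * v $ 2"
    by algebra+
  then show ?thesis by (simp add: vec_eq_iff forall_2 inner_vec_def sum_2)
qed

lemma frame_norm:
  assumes "frame u v"
  shows "(norm (c *\<^sub>R u + s *\<^sub>R v))\<^sup>2 = c\<^sup>2 + s\<^sup>2"
  using frame_inner[OF assms]
  by (simp add: power2_norm_eq_inner inner_add_left inner_add_right) (simp add: power2_eq_square)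

lemma frame_norm_eq_1_iff:
  assumes "frame u v"
  shows "norm x = 1 \<longleftrightarrow> (inner x u)\<^sup>2 + (inner x v)\<^sup>2 = 1"
proof -
  have "(norm x)\<^sup>2 = (inner x u)\<^sup>2 + (inner x v)\<^sup>2"
    using frame_norm[OF assms, of "inner x u" "inner x v"] by (simp flip: frame_expansion[OF assms])
  then show ?thesis using norm_ge_zero[of x] by (metis one_power2 power2_eq_imp_eq zero_le_one)
qed

lemma frame_coordinates:
  assumes "frame u v"
  shows "inner (c *\<^sub>R u + s *\<^sub>R v) u = c" "inner (c *\<^sub>R u + s *\<^sub>R v) v = s"
  using frame_inner[OF assms] by (simp_all add: inner_add_left)

lemma frame_eq_iff:
  assumes "frame u v"
  shows "c *\<^sub>R u + s *\<^sub>R v = c' *\<^sub>R u + s' *\<^sub>R v \<longleftrightarrow> c = c' \<and> s = s'"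
  using frame_coordinates[OF assms] by metis

lemma frame_eqI:
  assumes "frame u v" "inner x u = inner y u" "inner x v = inner y v"
  shows "x = y"
  using frame_expansion[OF assms(1), of x] frame_expansion[OF assms(1), of y] assms(2,3) by simp

section \<open>Perpendiculars at a point of a line\<close>

lemma drawn_unit_vector:
  assumes "yields_point P S q" "yields_point P S (q + e)" "norm e = 1"
  shows "drawn P S q e"
  by (rule drawn_join_towards[OF assms(1,2), of 1]) (use assms(3) in auto)

lemma yields_antipode:
  assumes "yields_point P S q" "yields_point P S (q + e)" "norm e = 1"
  shows "yields_point P S (q + (- e))"
  using drawn_endpoint[OF drawn_minus[OF drawn_unit_vector[OF assms]]] assms(3)
  by (simp add: sgn_div_norm)

lemma scaleR_double: "(2 * c) *\<^sub>R (x :: point) = c *\<^sub>R x + c *\<^sub>R x"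
  by (metis mult_2 scaleR_left_distrib)

text \<open>
  Let \<open>p\<close> be the second intersection of the line with the unit circle around \<open>C = q + e\<close>. The point
  opposite to \<open>p\<close> on that circle sees the chord from \<open>p\<close> to \<open>q\<close> under a right angle. In the case
  \<open>p = q\<close> the stick from \<open>q\<close> to \<open>C\<close> is itself perpendicular, and the formula remains true.
\<close>
lemma thales_point:
  assumes f: "frame u v" and l: "drawn P S q u"
    and C: "yields_point P S (q + e)" "norm e = 1"
  shows "yields_point P S (q + (2 * inner e v) *\<^sub>R v)"
proof -
  define c s p where "c = inner e u" and "s = inner e v" and "p = q + (2 * c) *\<^sub>R u"
  define e' where "e' = (- c) *\<^sub>R u + s *\<^sub>R v"
  have e: "e = c *\<^sub>R u + s *\<^sub>R v"
    using frame_expansion[OF f] by (simp add: c_def s_def)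
  have Cp: "q + e = p + e'"
    unfolding e e'_def p_def scaleR_double by simp
  have "c\<^sup>2 + s\<^sup>2 = 1" using C(2) unfolding frame_norm_eq_1_iff[OF f] c_def s_def .
  then have n: "norm e' = 1"
    unfolding frame_norm_eq_1_iff[OF f] e'_def frame_coordinates[OF f] by simp
  have p: "yields_point P S p"
    using drawn_unit_distance_point[OF l C(1) p_def] n Cp by (simp add: dist_norm)
  have "drawn P S p e'"
    using drawn_unit_vector[OF p _ n] C(1) Cp by simp
  then have "yields_point P S (p + sgn e' + sgn e')"
    by (intro drawn_endpoint drawn_next)
  moreover have "p + sgn e' + sgn e' = q + (2 * s) *\<^sub>R v"
  proof -
    have "p + sgn e' + sgn e' = (q + e) + e'" using n Cp by (simp add: sgn_div_norm)
    then show ?thesis unfolding e e'_def scaleR_double by simp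
  qed
  ultimately show ?thesis by (simp add: s_def)
qed

lemma drawn_through_close_points:
  assumes v: "norm v = 1" and q: "yields_point P S q"
    and "yields_point P S (q + \<sigma> *\<^sub>R v)" "yields_point P S (q + \<tau> *\<^sub>R v)"
    and "\<sigma> \<noteq> \<tau>" "\<bar>\<sigma> - \<tau>\<bar> \<le> 1"
  shows "drawn P S q v"
proof -
  have *: "drawn P S q v"
    if "yields_point P S (q + \<sigma> *\<^sub>R v)" "yields_point P S (q + \<tau> *\<^sub>R v)" "\<sigma> < \<tau>" "\<tau> - \<sigma> \<le> 1" for \<sigma> \<tau>
  proof -
    have "drawn P S (q + \<sigma> *\<^sub>R v) v"
      by (rule drawn_join_towards[OF that(1,2), of "\<tau> - \<sigma>"]) (use that v in \<open>auto simp: algebra_simps\<close>)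
    then show ?thesis
      using drawn_along[of P S "q + \<sigma> *\<^sub>R v" v q "- \<sigma>" 1] q by (simp add: algebra_simps)
  qed
  then show ?thesis
  proof (cases "\<sigma> < \<tau>")
    case True
    then show ?thesis using *[OF assms(3,4)] assms by simp
  next
    case False
    then show ?thesis using *[OF assms(4,3)] assms by simp
  qed
qed

text \<open>
  Thales' theorem yields points at heights \<open>2 s\<close> and \<open>2 t\<close> above \<open>q\<close> with \<open>0 < s, t \<le> 1\<close> (replacing a unit
  vector by its opposite if necessary). If \<open>s\<close> or \<open>t\<close> is at most \<open>1/2\<close>, that point can be joined with
  \<open>q\<close>; otherwise the two points differ by less than a unit.
\<close>
lemma drawn_perpendicular_from_two_heights:
  assumes f: "frame u v" and l: "drawn P S q u"
    and x: "yields_point P S (q + x)" "norm x = 1" and y: "yields_point P S (q + y)" "norm y = 1"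
    and ne: "inner x v \<noteq> 0" "inner y v \<noteq> 0" "\<bar>inner x v\<bar> \<noteq> \<bar>inner y v\<bar>"
  shows "drawn P S q v"
proof -
  have q: "yields_point P S q" using l by (rule drawn_point)
  have v: "norm v = 1" using f by (simp add: frame_def)
  have h: "yields_point P S (q + (2 * \<bar>inner e v\<bar>) *\<^sub>R v)" "\<bar>inner e v\<bar> \<le> 1"
    if e: "yields_point P S (q + e)" "norm e = 1" for e
  proof -
    show "\<bar>inner e v\<bar> \<le> 1"
      using Cauchy_Schwarz_ineq2[of e v] e v by simp
    show "yields_point P S (q + (2 * \<bar>inner e v\<bar>) *\<^sub>R v)"
      using thales_point[OF f l e] thales_point[OF f l yields_antipode[OF q e]] e(2)
      by (cases "inner e v \<ge> 0") auto
  qed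
  have q0: "yields_point P S (q + 0 *\<^sub>R v)" using q by simp
  consider "\<bar>inner x v\<bar> \<le> 1/2" | "\<bar>inner y v\<bar> \<le> 1/2"
    | "\<bar>inner x v\<bar> > 1/2" "\<bar>inner y v\<bar> > 1/2" by linarith
  then show ?thesis
  proof cases
    case 1
    then show ?thesis
      by (intro drawn_through_close_points[OF v q q0 h(1)[OF x]]) (use ne in auto)
  next
    case 2
    then show ?thesis
      by (intro drawn_through_close_points[OF v q q0 h(1)[OF y]]) (use ne in auto)
  next
    case 3
    then show ?thesis
      using h(2)[OF x] h(2)[OF y] ne
      by (intro drawn_through_close_points[OF v q h(1)[OF x] h(1)[OF y]]) linarith+
  qed
qed

lemma unit_vectors_of_equal_height:
  assumes f: "frame u v" and n: "norm x = 1" "norm y = 1" and h: "\<bar>inner x v\<bar> = \<bar>inner y v\<bar>"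
    and "x \<noteq> y" "x \<noteq> - y"
  shows "inner x u = - inner y u \<and> inner x v = inner y v \<or> inner x u = inner y u \<and> inner x v = - inner y v"
proof -
  have "(inner x v)\<^sup>2 = (inner y v)\<^sup>2" using h by (metis power2_abs)
  then have "(inner x u)\<^sup>2 = (inner y u)\<^sup>2"
    using n[unfolded frame_norm_eq_1_iff[OF f]] by linarith
  then have "inner x u = inner y u \<or> inner x u = - inner y u" by (simp add: power2_eq_iff)
  moreover have "inner x v = inner y v \<or> inner x v = - inner y v" using h by linarith
  moreover have "\<not> (inner x u = inner y u \<and> inner x v = inner y v)"
    using frame_eqI[OF f, of x y] \<open>x \<noteq> y\<close> by blast
  moreover have "\<not> (inner x u = - inner y u \<and> inner x v = - inner y v)"
    using frame_eqI[OF f, of x "- y"] \<open>x \<noteq> - y\<close> unfolding inner_minus_left by blast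
  ultimately show ?thesis by blast
qed

text \<open>
  Up to sign, only two unit vectors have a given height up to sign: a vector and its mirror image.
\<close>
lemma two_heights_among_three:
  assumes f: "frame u v" and n: "norm x = 1" "norm y = 1" "norm z = 1"
    and "x \<noteq> y" "x \<noteq> - y" "x \<noteq> z" "x \<noteq> - z" "y \<noteq> z" "y \<noteq> - z"
  shows "\<bar>inner x v\<bar> \<noteq> \<bar>inner y v\<bar> \<or> \<bar>inner x v\<bar> \<noteq> \<bar>inner z v\<bar>"
proof (rule ccontr)
  assume "\<not> ?thesis"
  then have h: "\<bar>inner x v\<bar> = \<bar>inner y v\<bar>" "\<bar>inner x v\<bar> = \<bar>inner z v\<bar>" by auto
  have "y = z \<or> y = - z"
    using unit_vectors_of_equal_height[OF f n(1,2) h(1)] unit_vectors_of_equal_height[OF f n(1,3) h(2)]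
      frame_eqI[OF f, of y z] frame_eqI[OF f, of y "- z"] assms by auto
  then show False using assms by blast
qed

lemma unit_vector_off_axis:
  assumes f: "frame u v" and "norm x = 1" "x \<noteq> u" "x \<noteq> - u"
  shows "inner x v \<noteq> 0"
proof
  assume h: "inner x v = 0"
  then have "(inner x u)\<^sup>2 = 1" using frame_norm_eq_1_iff[OF f] assms by simp
  then have "inner x u = 1 \<or> inner x u = - 1" by (simp add: power2_eq_1_iff)
  then show False using h frame_expansion[OF f, of x] assms by auto
qed

text \<open>
  Laying sticks from \<open>q\<close> to finitely many unit distance points and their antipodes forces the
  arbitrary point onto a new line through \<open>q\<close>.
\<close>
lemma drawn_by_choice_of_direction:
  assumes "d \<noteq> 0" and q: "yields_point P S q" and N: "finite N"
    "\<And>x. x \<in> N \<Longrightarrow> norm x = 1 \<and> yields_point P S (q + x)"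
    and indep: "\<And>e. \<lbrakk>norm e = 1; \<forall>x\<in>N. e \<noteq> x \<and> e \<noteq> - x\<rbrakk> \<Longrightarrow> drawn (insert (q + e) P) S a d"
  shows "drawn P S a d"
proof (rule drawn_by_choice_at_unit_distance[OF assms(1,2)])
  let ?M = "(\<lambda>x. q + x) ` (N \<union> uminus ` N)"
  show "finite ?M" using N(1) by simp
  show "dist q X = 1 \<and> yields_point P S X" if "X \<in> ?M" for X
    using that N(2) yields_antipode[OF q] by (force simp: dist_norm)
  fix C assume C: "dist q C = 1" "C \<notin> ?M"
  have "drawn (insert (q + (C - q)) P) S a d"
  proof (rule indep)
    show "norm (C - q) = 1" using C(1) by (simp add: dist_norm norm_minus_commute)
    have "C - q \<notin> N \<union> uminus ` N"
    proof
      assume "C - q \<in> N \<union> uminus ` N"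
      then have "C \<in> ?M" by (intro image_eqI[of C _ "C - q"]) auto
      then show False using C(2) by contradiction
    qed
    then show "\<forall>x\<in>N. C - q \<noteq> x \<and> C - q \<noteq> - x" by auto
  qed
  then show "drawn (insert C P) S a d" by simp
qed

theorem drawn_perpendicular_at:
  assumes f: "frame u v" and l: "drawn P S q u"
  shows "drawn P S q v"
proof -
  have u: "norm u = 1" and v0: "v \<noteq> 0" using f by (auto simp: frame_def)
  have q: "yields_point P' S q" if "P \<subseteq> P'" for P'
    using yields_more[OF drawn_point[OF l] that order_refl] .
  have qu: "yields_point P' S (q + u)" if "P \<subseteq> P'" for P'
    using yields_more[OF drawn_endpoint[OF l] that order_refl] u by (simp add: sgn_div_norm)
  have given: "yields_point P' S X" if "X \<in> P'" for P' X using that by (simp add: yields_given)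
  show ?thesis
  proof (rule drawn_by_choice_of_direction[OF v0 q, where N = "{u}"])
    fix x assume x: "norm x = 1" "\<forall>w\<in>{u}. x \<noteq> w \<and> x \<noteq> - w"
    let ?P1 = "insert (q + x) P"
    show "drawn ?P1 S q v"
    proof (rule drawn_by_choice_of_direction[OF v0 q, where N = "{u, x}"])
      fix y assume y: "norm y = 1" "\<forall>w\<in>{u, x}. y \<noteq> w \<and> y \<noteq> - w"
      let ?P2 = "insert (q + y) ?P1"
      show "drawn ?P2 S q v"
      proof (rule drawn_by_choice_of_direction[OF v0 q, where N = "{u, x, y}"])
        fix z assume z: "norm z = 1" "\<forall>w\<in>{u, x, y}. z \<noteq> w \<and> z \<noteq> - w"
        let ?P3 = "insert (q + z) ?P2"
        have l3: "drawn ?P3 S q u" by (rule drawn_more[OF l]) auto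
        have g: "yields_point ?P3 S (q + x)" "yields_point ?P3 S (q + y)" "yields_point ?P3 S (q + z)"
          by (intro given; simp)+
        have h: "inner x v \<noteq> 0" "inner y v \<noteq> 0" "inner z v \<noteq> 0"
          using unit_vector_off_axis[OF f] x y z by simp_all
        have "\<bar>inner z v\<bar> \<noteq> \<bar>inner y v\<bar> \<or> \<bar>inner z v\<bar> \<noteq> \<bar>inner x v\<bar>"
          using two_heights_among_three[OF f z(1) y(1) x(1)] y z by simp
        then show "drawn ?P3 S q v"
          using drawn_perpendicular_from_two_heights[OF f l3 g(3) z(1) g(2) y(1) h(3,2)]
            drawn_perpendicular_from_two_heights[OF f l3 g(3) z(1) g(1) x(1) h(3,1)] by blast
      qed (use u x y qu[of ?P2] given[of _ ?P2] in auto)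
    qed (use u x qu[of ?P1] given[of _ ?P1] in auto)
  qed (use u qu[of P] in auto)
qed


corollary drawn_perpendicular:
  assumes "drawn P S q d" "w \<noteq> 0" "inner d w = 0"
  shows "drawn P S q w"
proof -
  have d: "d \<noteq> 0" using assms(1) by (rule drawn_nonzero)
  have "frame (sgn d) (sgn w)"
    using d assms by (simp add: frame_def norm_sgn sgn_div_norm)
  moreover have "drawn P S q (sgn d)"
    using drawn_scale[OF assms(1), of "inverse (norm d)"] d by (simp add: sgn_div_norm)
  ultimately have "drawn P S q (sgn w)" by (rule drawn_perpendicular_at)
  then show ?thesis
    using drawn_scale[of P S q "sgn w" "norm w"] assms(2) by (simp add: sgn_div_norm)
qed

section \<open>Parallels and feet of perpendiculars\<close>

text \<open>
  The unit circle around \<open>X = a + x u + h v\<close> meets the line at \<open>x - c\<close>, and a unit step from there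
  leads to \<open>x + (1 - c)\<close>. Its squared distance to \<open>X\<close> is \<open>2 - 2 c \<le> 1\<close>, so it can be
  joined with \<open>X\<close>, and there the perpendicular to the joining stick can be erected.
\<close>
lemma drawn_altitude_line:
  assumes f: "frame u v" and l: "drawn P S a u" and X: "yields_point P S (a + x *\<^sub>R u + h *\<^sub>R v)"
    and h: "h \<noteq> 0" "\<bar>h\<bar> \<le> 1/2" and c: "c\<^sup>2 + h\<^sup>2 = 1" "1/2 \<le> c" "c < 1"
  shows "drawn P S (a + (x + (1 - c)) *\<^sub>R u) (h *\<^sub>R u + (1 - c) *\<^sub>R v)"
proof -
  have u: "norm u = 1" using f by (simp add: frame_def)
  let ?X = "a + x *\<^sub>R u + h *\<^sub>R v"
  define p where "p = a + (x - c) *\<^sub>R u"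
  have "?X - p = c *\<^sub>R u + h *\<^sub>R v" by (simp add: p_def scaleR_left_diff_distrib)
  then have "norm (?X - p) = 1"
    unfolding frame_norm_eq_1_iff[OF f] using c(1) by (simp only: frame_coordinates[OF f])
  then have p: "yields_point P S p"
    using drawn_unit_distance_point[OF l X p_def] by (simp only: dist_norm)
  have "yields_point P S (p + u)"
    using drawn_endpoint[OF drawn_forward[OF l p[unfolded p_def]]] u by (simp add: sgn_div_norm p_def)
  moreover have "p + u = a + (x + (1 - c)) *\<^sub>R u"
    by (simp add: p_def scaleR_left_diff_distrib scaleR_left_distrib)
  ultimately have q: "yields_point P S (a + (x + (1 - c)) *\<^sub>R u)" by simp
  have e: "?X - (a + (x + (1 - c)) *\<^sub>R u) = (c - 1) *\<^sub>R u + h *\<^sub>R v"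
    by (simp add: scaleR_left_diff_distrib scaleR_left_distrib)
  have "(norm ((c - 1) *\<^sub>R u + h *\<^sub>R v))\<^sup>2 = 2 - 2 * c"
    using c(1) unfolding frame_norm[OF f] by (simp add: power2_diff)
  also have "\<dots> \<le> 1\<^sup>2" using c by simp
  finally have n: "norm ((c - 1) *\<^sub>R u + h *\<^sub>R v) \<le> 1" by (rule power2_le_imp_le) simp
  have nz: "s *\<^sub>R u + t *\<^sub>R v \<noteq> 0" if "s \<noteq> 0" for s t
    using frame_eq_iff[OF f, of s t 0 0] that by simp
  have "drawn P S (a + (x + (1 - c)) *\<^sub>R u) ((c - 1) *\<^sub>R u + h *\<^sub>R v)"
    using n c(3) e by (intro drawn_join_towards[OF q X, of 1] nz) (auto simp: algebra_simps)
  then show ?thesis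
  proof (rule drawn_perpendicular)
    show "h *\<^sub>R u + (1 - c) *\<^sub>R v \<noteq> 0" using h(1) by (rule nz)
    show "inner ((c - 1) *\<^sub>R u + h *\<^sub>R v) (h *\<^sub>R u + (1 - c) *\<^sub>R v) = 0"
      using frame_inner[OF f] by (simp add: inner_add_left inner_add_right algebra_simps)
  qed
qed

text \<open>
  The lines of \<open>drawn_altitude_line\<close> for \<open>u\<close> and for \<open>- u\<close> are mirror images with respect to
  the perpendicular through \<open>X\<close>, so they meet on it. Their intersection and \<open>X\<close> are diametrically
  opposite on the circumcircle of \<open>X\<close> and the two base points; the bound on \<open>h\<close> keeps its
  diameter \<open>2 (1 - c) / \<bar>h\<bar>\<close> below a unit.
\<close>
lemma drawn_parallel_near:
  assumes f: "frame u v" and l: "drawn P S a u" and X: "yields_point P S (a + x *\<^sub>R u + h *\<^sub>R v)"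
    and h: "h \<noteq> 0" "\<bar>h\<bar> \<le> 1/2"
  shows "drawn P S (a + x *\<^sub>R u + h *\<^sub>R v) u"
proof -
  let ?X = "a + x *\<^sub>R u + h *\<^sub>R v"
  define c where "c = sqrt (1 - h\<^sup>2)"
  have "\<bar>h\<bar>\<^sup>2 \<le> (1/2)\<^sup>2" using h by (intro power_mono) auto
  then have h2: "0 < h\<^sup>2" "h\<^sup>2 \<le> 1/4" using h by (simp_all add: power_divide)
  then have c: "c\<^sup>2 + h\<^sup>2 = 1" by (simp add: c_def)
  have "(1/2)\<^sup>2 \<le> c\<^sup>2" using c h2 by (simp add: power2_eq_square)
  then have c': "1/2 \<le> c" by (rule power2_le_imp_le) (use h2 in \<open>simp add: c_def\<close>)
  have c'': "c < 1" using h2 by (simp add: c_def)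
  define k where "k = - (2 * (1 - c) / h)"
  have f': "frame (- u) v" using f by (simp add: frame_def)
  have X': "a + (- x) *\<^sub>R (- u) + h *\<^sub>R v = ?X" by simp
  let ?d = "h *\<^sub>R u + (1 - c) *\<^sub>R v" and ?e = "(- h) *\<^sub>R u + (1 - c) *\<^sub>R v"
  have d: "drawn P S (a + (x + (1 - c)) *\<^sub>R u) ?d"
    by (rule drawn_altitude_line[OF f l X h c c' c''])
  have "drawn P S (a + (- x + (1 - c)) *\<^sub>R (- u)) (h *\<^sub>R (- u) + (1 - c) *\<^sub>R v)"
    using drawn_altitude_line[OF f' drawn_minus[OF l], of "- x" h c] X' X h c c' c'' by simp
  moreover have "a + (- x + (1 - c)) *\<^sub>R (- u) = a + (x - (1 - c)) *\<^sub>R u"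
    by (simp add: algebra_simps)
  moreover have "h *\<^sub>R (- u) + (1 - c) *\<^sub>R v = ?e" by simp
  ultimately have e: "drawn P S (a + (x - (1 - c)) *\<^sub>R u) ?e" by (simp only:)
  have k: "h + k = - ((1 - c) / h * (1 - c))"
    using h(1) arg_cong[OF c, of "\<lambda>z. h * z"] by (simp add: k_def field_simps power2_eq_square)
  have Y: "yields_point P S (?X + k *\<^sub>R v)"
  proof (rule drawn_line_intersection[OF d e])
    have rh: "- ((1 - c) / h) * h = - (1 - c)" "- ((1 - c) / h) * - h = 1 - c"
      using h(1) by simp_all
    have *: "?X + k *\<^sub>R v = a + x *\<^sub>R u + (h + k) *\<^sub>R v" by (simp add: scaleR_left_distrib)
    show "?X + k *\<^sub>R v = a + (x + (1 - c)) *\<^sub>R u + (- ((1 - c) / h)) *\<^sub>R ?d"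
      unfolding * k scaleR_right_distrib scaleR_scaleR rh
      by (simp add: scaleR_left_distrib scaleR_left_diff_distrib)
    show "?X + k *\<^sub>R v = a + (x - (1 - c)) *\<^sub>R u + (- ((1 - c) / h)) *\<^sub>R ?e"
      unfolding * k scaleR_right_distrib scaleR_scaleR rh
      by (simp add: scaleR_left_distrib scaleR_left_diff_distrib)
    show "?d \<noteq> r *\<^sub>R ?e" for r
    proof
      assume "?d = r *\<^sub>R ?e"
      then have "?d = (- (r * h)) *\<^sub>R u + (r * (1 - c)) *\<^sub>R v"
        by (simp add: scaleR_right_diff_distrib)
      then have "h = - (r * h)" "1 - c = r * (1 - c)" unfolding frame_eq_iff[OF f] by auto
      then show False using c'' h(1) by simp
    qed
  qed
  \<comment> \<open>As \<open>h\<^sup>2 = (1 - c) (1 + c)\<close>, the number \<open>1 - c\<close> is of second order in \<open>h\<close>.\<close>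
  have "2 * (1 - c) \<le> \<bar>h\<bar>"
  proof -
    have "(1 - c) * (3/2) \<le> (1 - c) * (1 + c)" using c' c'' by (intro mult_left_mono) auto
    also have "\<dots> = \<bar>h\<bar> * \<bar>h\<bar>" using c by (simp add: algebra_simps power2_eq_square)
    also have "\<dots> \<le> \<bar>h\<bar> * (1/2)" using h by (intro mult_left_mono) auto
    finally show ?thesis by simp
  qed
  then have k1: "k \<noteq> 0" "\<bar>k\<bar> \<le> 1"
    using h(1) c'' by (simp_all add: k_def abs_mult divide_le_eq_1)
  have v: "norm v = 1" "v \<noteq> 0" using f by (auto simp: frame_def)
  have "drawn P S ?X (k *\<^sub>R v)"
    using k1 v by (intro drawn_join_towards[OF X Y, of 1]) auto
  then show ?thesis
    using f by (rule_tac drawn_perpendicular) (auto simp: frame_def inner_commute)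
qed

text \<open>
  Perpendiculars erected at the grid points of the given line, and then at the grid points of such
  a perpendicular, provide the parallels at all integer distances. Rounding the distance of \<open>X\<close>
  selects the nearest one.
\<close>
theorem drawn_parallel:
  assumes f: "frame u v" and l: "drawn P S a u" and X: "yields_point P S X"
  shows "drawn P S X u"
proof -
  have v: "norm v = 1" using f by (simp add: frame_def)
  define k where "k = round (inner (X - a) v)"
  define a' where "a' = a + real_of_int k *\<^sub>R v"
  define x h where "x = inner (X - a') u" and "h = inner (X - a') v"
  have "drawn P S a' v"
    using drawn_steps[OF drawn_perpendicular_at[OF f l], of k] v by (simp add: a'_def sgn_div_norm)
  then have l': "drawn P S a' u" by (rule drawn_perpendicular_at[OF frame_swap[OF f]])
  have "h = inner (X - a) v - real_of_int k"
    using frame_inner[OF f] by (simp add: h_def a'_def inner_diff_left inner_add_left)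
  then have h: "\<bar>h\<bar> \<le> 1/2"
    using of_int_round_abs_le[of "inner (X - a) v"] by (simp add: k_def abs_minus_commute)
  have "X - a' = x *\<^sub>R u + h *\<^sub>R v" unfolding x_def h_def by (rule frame_expansion[OF f])
  then have e: "X = a' + x *\<^sub>R u + h *\<^sub>R v" by (simp add: algebra_simps)
  show ?thesis
  proof (cases "h = 0")
    case True
    then show ?thesis using drawn_forward[OF l', of x] X e by simp
  next
    case False
    then show ?thesis using drawn_parallel_near[OF f l', of x h] X e h by simp
  qed
qed

lemma yields_foot:
  assumes f: "frame u v" and l: "drawn P S a u" and X: "yields_point P S X"
  shows "yields_point P S (a + inner (X - a) u *\<^sub>R u)"
proof (rule drawn_line_intersection[OF l])
  show "drawn P S X v"
    using drawn_perpendicular_at[OF f drawn_parallel[OF f l X]] .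
  have "X - a = inner (X - a) u *\<^sub>R u + inner (X - a) v *\<^sub>R v" by (rule frame_expansion[OF f])
  then show "a + inner (X - a) u *\<^sub>R u = X + (- inner (X - a) v) *\<^sub>R v"
    by (metis (no_types, lifting) add_diff_cancel_right' add_diff_eq diff_add_cancel
        diff_minus_eq_add scaleR_minus_left add.commute uminus_add_conv_diff)
  show "u \<noteq> k *\<^sub>R v" for k
    using frame_inner[OF f] by (metis inner_scaleR_left mult_zero_right zero_neq_one inner_commute)
qed (rule refl)

text \<open>
  One step takes the foot on the line in direction \<open>e\<close> and then its foot on the original line; each
  of the two multiplies the distance to \<open>a\<close> by the cosine of their angle.
\<close>
lemma yields_shrunk:
  assumes u: "norm u = 1" "drawn P S a u" and e: "norm e = 1" "drawn P S a e"
    and x: "yields_point P S (a + x *\<^sub>R u)"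
  shows "yields_point P S (a + (((inner u e)\<^sup>2) ^ n * x) *\<^sub>R u)"
proof (induction n)
  case (Suc n)
  obtain v where v: "frame u v" using obtain_frame u(1) .
  obtain w where w: "frame e w" using obtain_frame e(1) .
  from yields_foot[OF v u(2) yields_foot[OF w e(2) Suc]]
  show ?case by (simp add: inner_commute[of e u] power2_eq_square mult_ac)
qed (use x in simp)

section \<open>The line through two given points\<close>

theorem drawn_line_through:
  assumes "A \<in> P" "B \<in> P" "A \<noteq> B"
  shows "drawn P S A (B - A)"
proof -
  have nz: "B - A \<noteq> 0" using assms by simp
  have A: "yields_point P' S A" and B: "yields_point P' S B" if "P \<subseteq> P'" for P'
    using assms that by (auto intro: yields_given)
  show ?thesis
  proof (rule drawn_by_choice_of_direction[OF nz A, where N = "{}"])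
    fix u :: point assume u: "norm u = 1"
    let ?P1 = "insert (A + u) P"
    obtain v where f: "frame u v" using obtain_frame u .
    then have v: "norm v = 1" by (simp add: frame_def)
    have u1: "drawn ?P1 S A u"
      by (rule drawn_unit_vector[OF A _ u]) (auto intro: yields_given)
    have v1: "drawn ?P1 S A v" by (rule drawn_perpendicular_at[OF f u1])
    show "drawn ?P1 S A (B - A)"
    proof (rule drawn_by_choice_of_direction[OF nz A, where N = "{u, v}"])
      fix e assume e: "norm e = 1" "\<forall>x\<in>{u, v}. e \<noteq> x \<and> e \<noteq> - x"
      let ?P2 = "insert (A + e) ?P1"
      define \<kappa> where "\<kappa> = (inner e u)\<^sup>2"
      \<comment> \<open>The quarter turn of \<open>e\<close> makes the same angle with \<open>v\<close> as \<open>e\<close> does with \<open>u\<close>, so both coordinates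
         shrink by the same factor \<open>\<kappa>\<close>.\<close>
      define e' where "e' = (- inner e v) *\<^sub>R u + inner e u *\<^sub>R v"
      have u2: "drawn ?P2 S A u" and v2: "drawn ?P2 S A v"
        by (rule drawn_more[OF u1] drawn_more[OF v1]; blast)+
      have e2: "drawn ?P2 S A e"
        by (rule drawn_unit_vector[OF A _ e(1)]) (auto intro: yields_given)
      have ne: "inner e u \<noteq> 0" "inner e v \<noteq> 0"
        using unit_vector_off_axis[OF f e(1)] unit_vector_off_axis[OF frame_swap[OF f] e(1)] e(2) by auto
      have sum1: "(inner e u)\<^sup>2 + (inner e v)\<^sup>2 = 1" using e(1) unfolding frame_norm_eq_1_iff[OF f] .
      have \<kappa>: "0 < \<kappa>" "\<kappa> < 1" 
        using ne sum1 zero_less_power2[of "inner e u"] zero_less_power2[of "inner e v"]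
        unfolding \<kappa>_def by (simp, linarith)
      have n': "norm e' = 1"
        using sum1 unfolding frame_norm_eq_1_iff[OF f] e'_def frame_coordinates[OF f] by simp
      have "inner e e' = 0" by (simp add: e'_def inner_diff_right)
      then have "frame e e'" using e(1) n' by (simp add: frame_def)
      then have e'2: "drawn ?P2 S A e'" using drawn_perpendicular_at e2 by blast
      define x y where "x = inner (B - A) u" and "y = inner (B - A) v"
      obtain n where "\<kappa> ^ n < 1 / norm (B - A)"
        using real_arch_pow_inv[of "1 / norm (B - A)" \<kappa>] \<kappa> nz by auto
      then have n: "\<kappa> ^ n * norm (B - A) \<le> 1" using nz by (simp add: pos_less_divide_eq)
      have "yields_point ?P2 S (A + (((inner u e)\<^sup>2) ^ n * x) *\<^sub>R u)"
        unfolding x_def by (intro yields_shrunk[OF u u2 e(1) e2] yields_foot[OF f u2] B) auto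
      then have px: "yields_point ?P2 S (A + (\<kappa> ^ n * x) *\<^sub>R u)" by (simp add: \<kappa>_def inner_commute)
      have "yields_point ?P2 S (A + (((inner v e')\<^sup>2) ^ n * y) *\<^sub>R v)"
        unfolding y_def
        by (intro yields_shrunk[OF v v2 n' e'2] yields_foot[OF frame_swap[OF f] v2] B) auto
      moreover have "inner v e' = inner e u"
        unfolding e'_def inner_commute[of v] by (rule frame_coordinates(2)[OF f])
      ultimately have py: "yields_point ?P2 S (A + (\<kappa> ^ n * y) *\<^sub>R v)" by (simp add: \<kappa>_def)
      have BA: "B - A = x *\<^sub>R u + y *\<^sub>R v" unfolding x_def y_def by (rule frame_expansion[OF f])
      have "yields_point ?P2 S (A + \<kappa> ^ n *\<^sub>R (B - A))"
      proof (rule drawn_line_intersection)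
        show "drawn ?P2 S (A + (\<kappa> ^ n * x) *\<^sub>R u) v"
          by (rule drawn_parallel[OF frame_swap[OF f] v2 px])
        show "drawn ?P2 S (A + (\<kappa> ^ n * y) *\<^sub>R v) u"
          by (rule drawn_parallel[OF f u2 py])
        show "A + \<kappa> ^ n *\<^sub>R (B - A) = A + (\<kappa> ^ n * x) *\<^sub>R u + (\<kappa> ^ n * y) *\<^sub>R v"
          "A + \<kappa> ^ n *\<^sub>R (B - A) = A + (\<kappa> ^ n * y) *\<^sub>R v + (\<kappa> ^ n * x) *\<^sub>R u"
          unfolding BA by (simp_all add: scaleR_right_distrib)
        show "v \<noteq> k *\<^sub>R u" for k
          using frame_inner[OF f] by (metis inner_scaleR_left mult_zero_right zero_neq_one)
      qed
      then show "drawn ?P2 S A (B - A)"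
        by (intro drawn_join_towards[OF A, of _ "A + \<kappa> ^ n *\<^sub>R (B - A)" "\<kappa> ^ n"])
          (use \<kappa> n nz in auto)
    qed (use u v A drawn_endpoint[OF u1] drawn_endpoint[OF v1] in \<open>auto simp: sgn_div_norm\<close>)
  qed auto
qed

lemma affine_hull_direction: "affine hull {a, a + d} = range (\<lambda>t. a + t *\<^sub>R (d :: point))"
  by (simp add: affine_hull_2_alt)

lemma is_line_direction: "d \<noteq> 0 \<Longrightarrow> is_line (affine hull {a, a + d})"
  unfolding is_line_def by (intro exI[of _ a] exI[of _ "a + d"]) simp

lemma constructible_if_drawn:
  assumes "drawn P S a d"
  shows "constructible (affine hull {a, a + d}) P S"
proof -
  let ?s = "closed_segment a (a + sgn d)" and ?L = "affine hull {a, a + d}"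
  have "?s \<subseteq> ?L"
  proof
    fix x assume "x \<in> ?s"
    then obtain t where "x = a + (t / norm d) *\<^sub>R d"
      by (auto simp: in_segment sgn_div_norm algebra_simps divide_inverse)
    then show "x \<in> ?L" unfolding affine_hull_direction by blast
  qed
  moreover have "is_line ?L" by (rule is_line_direction[OF drawn_nonzero[OF assms]])
  ultimately have "constructible ?L (P \<union> {}) (S \<union> {?s})"
    by (intro constructible.finished) (auto simp: line_given_def)
  then show ?thesis by (rule yieldsD[OF drawn_stick[OF assms] order_refl order_refl])
qed

lemma drawn_if_line_given:
  assumes "\<forall>s\<in>S. is_stick s" "line_given S l"
  obtains c d where "norm d = 1" "drawn P S c d" "l = affine hull {c, c + d}"
proof -
  obtain a b s where l: "a \<noteq> b" "l = affine hull {a, b}" and s: "s \<in> S" "s \<subseteq> l"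
    using assms(2) by (auto simp: line_given_def is_line_def)
  obtain c c' where c: "dist c c' = 1" "s = closed_segment c c'"
    using assms(1) s by (auto simp: is_stick_def)
  define d where "d = c' - c"
  have d: "norm d = 1" "s = closed_segment c (c + d)"
    using c by (simp_all add: d_def dist_norm norm_minus_commute)
  have ys: "yields_stick P S s" using s by (simp add: yields_given)
  have "yields_point P S c"
    by (rule yields_extremity[OF ys]) (use c in \<open>auto simp: extremities_def\<close>)
  then have "drawn P S c d" using d ys by (intro drawnI) (auto simp: sgn_div_norm)
  moreover have "l = affine hull {c, c + d}"
  proof
    have cl: "c \<in> l" "c + d \<in> l" using s d(2) by auto
    then show "affine hull {c, c + d} \<subseteq> l" unfolding l(2) by (intro hull_minimal) auto
    define w where "w = b - a"
    obtain r r' where r: "c = a + r *\<^sub>R w" "c + d = a + r' *\<^sub>R w"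
      using cl unfolding l(2) affine_hull_2_alt w_def by (elim rangeE) blast
    have dr: "d = (r' - r) *\<^sub>R w"
      unfolding scaleR_left_diff_distrib using r(2) unfolding r(1) by (simp add: algebra_simps)
    then have ne: "r' - r \<noteq> 0" using d(1) by auto
    show "l \<subseteq> affine hull {c, c + d}"
      unfolding l(2) affine_hull_direction unfolding affine_hull_2_alt w_def[symmetric]
    proof safe
      fix t
      have "((t - r) / (r' - r)) *\<^sub>R d = (t - r) *\<^sub>R w" unfolding dr using ne by simp
      then have "a + t *\<^sub>R w = c + ((t - r) / (r' - r)) *\<^sub>R d"
        by (simp add: r(1) scaleR_left_diff_distrib)
      then show "a + t *\<^sub>R w \<in> range (\<lambda>t. c + t *\<^sub>R d)" by blast
    qed
  qed
  ultimately show ?thesis using that d(1) by blast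
qed

theorem proposition6:
  fixes A B :: point and P :: "point set" and S :: "point set set"
  assumes "\<forall>s\<in>S. is_stick s" and "A \<in> P" and "B \<in> P" and "A \<noteq> B"
  shows "constructible (affine hull {A, B}) P S \<and>
    (\<forall>l. line_given S l \<longrightarrow>
      (\<exists>m. is_line m \<and> B \<in> m \<and> affine_parallel l m \<and> constructible m P S)) \<and>
    (\<forall>p. line_given S p \<longrightarrow>
      (\<exists>m. is_line m \<and> B \<in> m \<and> perpendicular p m \<and> constructible m P S))"
proof (intro conjI allI impI)
  have B: "yields_point P S B" using assms by (simp add: yields_given)
  have line: "is_line (affine hull {B, B + d})" if "norm d = 1" for d
    using that by (intro is_line_direction) auto
  show "constructible (affine hull {A, B}) P S"
    using constructible_if_drawn[OF drawn_line_through[OF assms(2-4)]] by simp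
  show "\<exists>m. is_line m \<and> B \<in> m \<and> affine_parallel l m \<and> constructible m P S"
    if l_given: "line_given S l" for l
  proof -
    obtain c d where d: "norm d = 1" "drawn P S c d" and l: "l = affine hull {c, c + d}"
      using drawn_if_line_given[OF assms(1) l_given] .
    obtain v where f: "frame d v" using obtain_frame d(1) .
    let ?m = "affine hull {B, B + d}"
    have "?m = (\<lambda>x. (B - c) + x) ` l"
      unfolding l affine_hull_direction by (auto simp: image_iff)
    then have "affine_parallel l ?m" by (auto simp: affine_parallel_def)
    moreover have "constructible ?m P S"
      by (rule constructible_if_drawn[OF drawn_parallel[OF f d(2) B]])
    ultimately show ?thesis using line[OF d(1)] hull_inc[of B "{B, B + d}"] by blast
  qed
  show "\<exists>m. is_line m \<and> B \<in> m \<and> perpendicular p m \<and> constructible m P S"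
    if p_given: "line_given S p" for p
  proof -
    obtain c d where d: "norm d = 1" "drawn P S c d" and p: "p = affine hull {c, c + d}"
      using drawn_if_line_given[OF assms(1) p_given] .
    obtain v where f: "frame d v" using obtain_frame d(1) .
    let ?m = "affine hull {B, B + v}"
    have "perpendicular p ?m"
      unfolding p affine_hull_direction perpendicular_def orthogonal_def
      using frame_inner[OF f] by (auto simp flip: scaleR_left_diff_distrib)
    moreover have "constructible ?m P S"
      using constructible_if_drawn[OF drawn_perpendicular_at[OF f drawn_parallel[OF f d(2) B]]] .
    moreover have "norm v = 1" using f by (simp add: frame_def)
    ultimately show ?thesis using line[of v] hull_inc[of B "{B, B + v}"] by blast
  qed
qed

end
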